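(* There exist $n\in\mathbb{N}$, $L>0$, a nonempty compact convex set $\mathcal{C}\subset\mathbb{R}^n$, an open convex set $\mathcal{D}\subset\mathbb{R}^n$ containing $\mathcal{C}$, a convex function $f\colon\mathcal{D}\to\mathbb{R}$ with $L$-Lipschitz-continuous gradient, and a point $x_0\in\mathcal{C}$ such that any sequence $(x_t)_{t\in\mathbb{N}}$ generated from $x_0$ by the Frank-Wolfe algorithm for minimizing $f$ over $\mathcal{C}$ using the line-search strategy does not converge.
   Context: $\mathbb{R}^n$ is equipped with the Euclidean inner product $\langle\cdot,\cdot\rangle$ and norm $\|\cdot\|$, and $\mathbb{N}=\{0,1,2,\ldots\}$. A sequence $(x_t)_{t\in\mathbb{N}}$ is generated by the Frank-Wolfe algorithm for minimizing $f$ over $\mathcal{C}$ from $x_0\in\mathcal{C}$ if for all $t\in\mathbb{N}$ there exist $v_t\in\operatorname{arg\,min}_{v\in\mathcal{C}}\langle v,\nabla f(x_t)\rangle$ and $\gamma_t\in[0,1]$ such that $x_{t+1}=(1-\gamma_t)x_t+\gamma_tv_t$. No restriction is made on which minimizer $v_t$ is selected: "any sequence" ranges over all possible choices of the $v_t$ and of the admissible $\gamma_t$. The algorithm uses the line-search strategy if $\gamma_t\in\operatorname{arg\,min}_{\gamma\in[0,1]}f(x_t+\gamma(v_t-x_t))$ for all $t\in\mathbb{N}$. *)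

theory Defs
  imports "HOL-Analysis.Analysis" "HOL-Library.Function_Algebras"
begin

text \<open>
  The dimension \<open>n\<close> is existentially quantified in the statement, so it cannot be a type.
  The space $\mathbb{R}^n$ is rendered as the carrier of the library topology
  \<^term>\<open>Euclidean_space n\<close>, i.e.\ as the functions \<open>x :: nat \<Rightarrow> real\<close> with \<open>x i = 0\<close> for all
  \<open>i \<ge> n\<close>. Pointwise addition comes from \<^theory>\<open>HOL-Library.Function_Algebras\<close>; the following
  instance adds pointwise scaling, so that \<^const>\<open>convex\<close> and \<^const>\<open>convex_on\<close> apply.
\<close>

instantiation "fun" :: (type, real_vector) real_vector
begin

definition scaleR_fun :: "real \<Rightarrow> ('a \<Rightarrow> 'b) \<Rightarrow> 'a \<Rightarrow> 'b"
  where "scaleR_fun c x = (\<lambda>i. c *\<^sub>R x i)"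

instance
  by standard (auto simp: scaleR_fun_def fun_eq_iff scaleR_add_right scaleR_add_left)

end

lemma scaleR_fun_apply [simp]: "(c *\<^sub>R x) i = c *\<^sub>R x i"
  by (simp add: scaleR_fun_def)

abbreviation Rn :: "nat \<Rightarrow> (nat \<Rightarrow> real) set"
  where "Rn n \<equiv> topspace (Euclidean_space n)"

definition inner_Rn :: "nat \<Rightarrow> (nat \<Rightarrow> real) \<Rightarrow> (nat \<Rightarrow> real) \<Rightarrow> real"
  where "inner_Rn n x y = (\<Sum>i<n. x i * y i)"

definition norm_Rn :: "nat \<Rightarrow> (nat \<Rightarrow> real) \<Rightarrow> real"
  where "norm_Rn n x = L2_set x {..<n}"

text \<open>
  Frechet differentiability of \<open>f\<close> at \<open>x\<close>, with gradient \<open>G\<close>. The filter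
  \<^term>\<open>atin (Euclidean_space n) x\<close> is that of the punctured neighbourhoods of \<open>x\<close> in
  $\mathbb{R}^n$; hence if \<open>x\<close> lies in an open set \<open>D\<close>, the values of \<open>f\<close> outside \<open>D\<close> are
  irrelevant.
\<close>

definition has_gradient_Rn ::
    "nat \<Rightarrow> ((nat \<Rightarrow> real) \<Rightarrow> real) \<Rightarrow> (nat \<Rightarrow> real) \<Rightarrow> (nat \<Rightarrow> real) \<Rightarrow> bool"
  where "has_gradient_Rn n f G x \<longleftrightarrow>
    G \<in> Rn n \<and>
    ((\<lambda>y. (f y - f x - inner_Rn n G (y - x)) / norm_Rn n (y - x)) \<longlongrightarrow> 0)
      (atin (Euclidean_space n) x)"

lemma has_gradient_Rn_unique:
  assumes G: "has_gradient_Rn n f G x" and H: "has_gradient_Rn n f H x" and x: "x \<in> Rn n"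
  shows "G = H"
proof (rule ccontr)
  assume "G \<noteq> H"
  define d where "d = H - G"
  have d: "d \<in> Rn n"
    using G H by (auto simp: d_def has_gradient_Rn_def topspace_Euclidean_space)
  have "d \<noteq> 0"
    using \<open>G \<noteq> H\<close> by (simp add: d_def)
  then obtain j where j: "d j \<noteq> 0"
    by (auto simp: fun_eq_iff)
  with d have "j < n"
    by (metis (mono_tags, lifting) linorder_not_less mem_Collect_eq topspace_Euclidean_space)
  with j have pos: "(\<Sum>i<n. (d i)\<^sup>2) > 0"
    by (intro sum_pos2[of _ j]) auto
  define F where
    "F = (\<lambda>K y. (f y - f x - inner_Rn n K (y - x)) / norm_Rn n (y - x))"
  have "(F G \<longlongrightarrow> 0) (atin (Euclidean_space n) x)" "(F H \<longlongrightarrow> 0) (atin (Euclidean_space n) x)"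
    using G H by (auto simp: has_gradient_Rn_def F_def)
  then have lim: "((\<lambda>y. F G y - F H y) \<longlongrightarrow> 0) (atin (Euclidean_space n) x)"
    using tendsto_diff by fastforce
  let ?p = "\<lambda>s. x + s *\<^sub>R d"
  have p: "filterlim ?p (atin (Euclidean_space n) x) (at_right (0::real))"
  proof -
    have cont: "continuous_map euclideanreal (Euclidean_space n) ?p"
      using x d unfolding Euclidean_space_def continuous_map_in_subtopology
      by (auto simp: continuous_map_componentwise_UNIV topspace_Euclidean_space
          intro!: continuous_intros)
    show ?thesis
      unfolding filterlim_iff
    proof (intro allI impI)
      fix P assume "eventually P (atin (Euclidean_space n) x)"
      then obtain U where U: "openin (Euclidean_space n) U" "x \<in> U" "\<And>y. y \<in> U - {x} \<Longrightarrow> P y"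
        using x by (auto simp: eventually_atin)
      have "open {s. ?p s \<in> U}"
        using openin_continuous_map_preimage[OF cont U(1)] by simp
      moreover have "(0::real) \<in> {s. ?p s \<in> U}"
        using U(2) by (simp add: fun_eq_iff)
      ultimately have "eventually (\<lambda>s. s \<in> {s. ?p s \<in> U}) (nhds 0)"
        using eventually_nhds by blast
      then have "eventually (\<lambda>s. ?p s \<in> U) (at_right 0)"
        by (auto simp: eventually_at_filter elim: eventually_mono)
      moreover have "eventually (\<lambda>s::real. s > 0) (at_right 0)"
        by (simp add: eventually_at_right_less)
      ultimately show "eventually (\<lambda>s. P (?p s)) (at_right 0)"
        by eventually_elim (use U \<open>d \<noteq> 0\<close> in auto)
    qed
  qed
  have "((\<lambda>s. F G (?p s) - F H (?p s)) \<longlongrightarrow> 0) (at_right 0)"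
    using filterlim_compose[OF lim p] .
  moreover have "eventually (\<lambda>s. F G (?p s) - F H (?p s) = sqrt (\<Sum>i<n. (d i)\<^sup>2)) (at_right 0)"
    using eventually_at_right_less
  proof eventually_elim
    fix s :: real assume s: "0 < s"
    have N: "norm_Rn n (?p s - x) = s * sqrt (\<Sum>i<n. (d i)\<^sup>2)"
      using s by (simp add: norm_Rn_def L2_set_def power_mult_distrib real_sqrt_mult
          flip: sum_distrib_left)
    have "inner_Rn n H (?p s - x) - inner_Rn n G (?p s - x) = s * (\<Sum>i<n. (d i)\<^sup>2)"
      by (simp add: inner_Rn_def d_def sum_distrib_left power2_eq_square algebra_simps
          sum.distrib sum_subtractf)
    then have "F G (?p s) - F H (?p s) = s * (\<Sum>i<n. (d i)\<^sup>2) / (s * sqrt (\<Sum>i<n. (d i)\<^sup>2))"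
      unfolding F_def N by (simp flip: diff_divide_distrib)
    then show "F G (?p s) - F H (?p s) = sqrt (\<Sum>i<n. (d i)\<^sup>2)"
      using s pos by (simp add: real_div_sqrt)
  qed
  ultimately have "((\<lambda>s::real. sqrt (\<Sum>i<n. (d i)\<^sup>2)) \<longlongrightarrow> 0) (at_right 0)"
    by (rule Lim_transform_eventually)
  then have "sqrt (\<Sum>i<n. (d i)\<^sup>2) = 0"
    by (simp add: tendsto_const_iff)
  with pos show False by simp
qed

text \<open>Here \<open>g\<close> plays the role of $\nabla f$.\<close>

definition frank_wolfe_run ::
    "nat \<Rightarrow> ((nat \<Rightarrow> real) \<Rightarrow> nat \<Rightarrow> real) \<Rightarrow> (nat \<Rightarrow> real) set
      \<Rightarrow> (nat \<Rightarrow> nat \<Rightarrow> real) \<Rightarrow> (nat \<Rightarrow> nat \<Rightarrow> real) \<Rightarrow> (nat \<Rightarrow> real) \<Rightarrow> bool"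
  where "frank_wolfe_run n g C x v \<gamma> \<longleftrightarrow>
    x 0 \<in> C \<and>
    (\<forall>t. is_arg_min (\<lambda>w. inner_Rn n w (g (x t))) (\<lambda>w. w \<in> C) (v t) \<and>
         \<gamma> t \<in> {0..1} \<and>
         x (Suc t) = (1 - \<gamma> t) *\<^sub>R x t + \<gamma> t *\<^sub>R v t)"

definition line_search ::
    "((nat \<Rightarrow> real) \<Rightarrow> real) \<Rightarrow> (nat \<Rightarrow> nat \<Rightarrow> real) \<Rightarrow> (nat \<Rightarrow> nat \<Rightarrow> real) \<Rightarrow> (nat \<Rightarrow> real) \<Rightarrow> bool"
  where "line_search f x v \<gamma> \<longleftrightarrow>
    (\<forall>t. is_arg_min (\<lambda>s. f (x t + s *\<^sub>R (v t - x t))) (\<lambda>s. s \<in> {0..1}) (\<gamma> t))"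

end

theory Submission
  imports Defs
begin

text \<open>
  The counterexample lives in the plane. The set is the rectangle $[-3,3] \times [0,1/2]$ and the
  objective is $F(a,b) = b^2 (1 + a^2) + \max(0, a^2 - 1/4)^3$, whose minimizers over the rectangle
  form the segment $[-1/2,1/2] \times \{0\}$ in the relative interior of the bottom edge.

  Let an iterate be $(1/2, b)$ with $b > 0$. Both partial derivatives of \<open>F\<close> are positive there, so the
  linear minimization oracle can only return the corner $(-3,0)$. On the segment towards that
  corner the second coordinate is proportional to $a + 3$, and
  $(a + 3)^2 (1 + a^2)$ has a strict local minimum at $a = -1/2$, where the cubic term still
  vanishes. By convexity of \<open>F\<close> this is the only minimizer on the segment, so exact
  line search moves the iterate to $(-1/2, 5b/7)$. The situation is symmetric under $a \mapsto -a$,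
  hence the iterates are forced to be $((-1)^t/2, (5/7)^t/2)$: they approach the set of
  minimizers at a linear rate, while their first coordinate jumps between the two
  ends of that set. The single step is \<open>frank_wolfe_step\<close>, which rests on
  \<open>lmo_unique\<close> and \<open>line_minimizer_unique\<close>.

  The cubic term has two purposes. The first summand alone is convex only as long as
  $3 a^2 \le 1$, and it vanishes at the corners $(\pm 3, 0)$, so that line search could run all the
  way into a corner. The cubic term restores convexity on $|b| \le 1$ (\<open>hessF_nonneg\<close>) without
  disturbing the strip $|a| \le 1/2$ between the iterates. Lipschitz continuity of the gradient
  is elementary because the functions are considered on a bounded neighbourhood only.
\<close>

section \<open>The objective function in two real variables\<close>

definition well :: "real \<Rightarrow> real"
  where "well a = max 0 (a\<^sup>2 - 1/4)"

definition F :: "real \<Rightarrow> real \<Rightarrow> real"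
  where "F a b = b\<^sup>2 * (1 + a\<^sup>2) + well a ^ 3"

definition dF1 :: "real \<Rightarrow> real \<Rightarrow> real"
  where "dF1 a b = 2 * a * b\<^sup>2 + 6 * a * (well a)\<^sup>2"

definition dF2 :: "real \<Rightarrow> real \<Rightarrow> real"
  where "dF2 a b = 2 * b * (1 + a\<^sup>2)"

lemma well_nonneg: "well a \<ge> 0"
  by (simp add: well_def)

lemma well_half [simp]: "well (1/2) = 0" "well (- (1/2)) = 0"
  by (simp_all add: well_def power2_eq_square)

text \<open>
  Only the kink needs an argument: at \<open>0\<close> the difference quotient is again a positive power of
  \<open>max 0 h\<close>, which tends to \<open>0\<close>.
\<close>

lemma DERIV_max_0_power:
  fixes u :: real
  shows "((\<lambda>u. max 0 u ^ Suc (Suc k)) has_real_derivative real (Suc (Suc k)) * max 0 u ^ Suc k) (at u)"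
proof -
  consider "u < 0" | "u = 0" | "u > 0" by linarith
  then show ?thesis
  proof cases
    case 1
    have "((\<lambda>_. 0::real) has_real_derivative 0) (at u)" by simp
    then have "((\<lambda>u::real. max 0 u ^ Suc (Suc k)) has_real_derivative 0) (at u)"
      by (rule has_field_derivative_transform_within_open[where S = "{..<0}"]) (use 1 in auto)
    then show ?thesis using 1 by simp
  next
    case 2
    have "((\<lambda>h::real. max 0 h ^ Suc k) \<longlongrightarrow> max 0 0 ^ Suc k) (at 0)"
      by (intro tendsto_intros)
    then have *: "((\<lambda>h::real. max 0 h ^ Suc k) \<longlongrightarrow> 0) (at 0)" by simp
    have "((\<lambda>h::real. max 0 h ^ Suc (Suc k) / h) \<longlongrightarrow> 0) (at 0)"
      by (rule Lim_transform_eventually[OF *])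
         (auto simp: eventually_at_filter max_def)
    then show ?thesis using 2 by (simp add: DERIV_def)
  next
    case 3
    have "((\<lambda>u. u ^ Suc (Suc k)) has_real_derivative real (Suc (Suc k)) * u ^ Suc k) (at u)"
      by (rule derivative_eq_intros refl | simp)+
    then have "((\<lambda>u::real. max 0 u ^ Suc (Suc k)) has_real_derivative real (Suc (Suc k)) * u ^ Suc k) (at u)"
      by (rule has_field_derivative_transform_within_open[where S = "{0<..}"]) (use 3 in auto)
    then show ?thesis using 3 by simp
  qed
qed

lemma DERIV_well_power:
  assumes "(h has_real_derivative h') (at s)"
  shows "((\<lambda>s. well (h s) ^ Suc (Suc k)) has_real_derivative
           real (Suc (Suc k)) * well (h s) ^ Suc k * (2 * h s * h')) (at s)"
proof -
  have "((\<lambda>s. (h s)\<^sup>2 - 1/4) has_real_derivative 2 * h s * h') (at s)"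
    by (rule derivative_eq_intros assms refl | simp)+
  from DERIV_chain2[OF DERIV_max_0_power this]
  show ?thesis by (simp add: well_def)
qed

lemma DERIV_F_line:
  "((\<lambda>s. F (a + s * c) (b + s * d)) has_real_derivative
      dF1 (a + s * c) (b + s * d) * c + dF2 (a + s * c) (b + s * d) * d) (at s)"
proof -
  have h: "((\<lambda>s. a + s * c) has_real_derivative c) (at s)"
    by (rule derivative_eq_intros refl | simp)+
  have w: "((\<lambda>s. well (a + s * c) ^ 3) has_real_derivative
      3 * (well (a + s * c))\<^sup>2 * (2 * (a + s * c) * c)) (at s)"
    using DERIV_well_power[OF h, of 1] by (simp add: numeral_3_eq_3 numeral_2_eq_2)
  show ?thesis
    unfolding F_def dF1_def dF2_def
    by (rule DERIV_cong, (rule w derivative_intros)+) (simp add: algebra_simps power2_eq_square)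
qed

text \<open>The Hessian of \<open>F\<close> at \<open>(a, b)\<close>, as a quadratic form in the direction \<open>(c, d)\<close>.\<close>

definition hessF :: "real \<Rightarrow> real \<Rightarrow> real \<Rightarrow> real \<Rightarrow> real"
  where "hessF a b c d = (2 * b\<^sup>2 + 6 * (well a)\<^sup>2 + 24 * a\<^sup>2 * well a) * c\<^sup>2
           + 8 * a * b * c * d + 2 * (1 + a\<^sup>2) * d\<^sup>2"

lemma DERIV_F_line2:
  "((\<lambda>s. dF1 (a + s * c) (b + s * d) * c + dF2 (a + s * c) (b + s * d) * d) has_real_derivative
      hessF (a + s * c) (b + s * d) c d) (at s)"
proof -
  have h: "((\<lambda>s. a + s * c) has_real_derivative c) (at s)"
    by (rule derivative_eq_intros refl | simp)+
  have w: "((\<lambda>s. (well (a + s * c))\<^sup>2) has_real_derivative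
      2 * well (a + s * c) * (2 * (a + s * c) * c)) (at s)"
    using DERIV_well_power[OF h, of 0] by (simp add: numeral_2_eq_2)
  show ?thesis
    unfolding dF1_def dF2_def hessF_def
    by (rule DERIV_cong, (rule w derivative_intros)+) (simp add: algebra_simps power2_eq_square)
qed

text \<open>
  Completing the square in \<open>d\<close> leaves the determinant condition \<open>key\<close>. Where the well is flat,
  $a^2 \le 1/4$ makes its left-hand side nonpositive; elsewhere $a^2 = m + 1/4$, the left-hand
  side is at most $3m$, and the second derivative of $m^3$ contributes $12 a^2 m \ge 3m$ to the right-hand side.
\<close>

lemma hessF_nonneg:
  assumes "\<bar>b\<bar> \<le> 1"
  shows "hessF a b c d \<ge> 0"
proof -
  define m where "m = well a"
  have m: "m \<ge> 0" "a\<^sup>2 \<le> m + 1/4" by (auto simp: m_def well_def)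
  have b: "b\<^sup>2 \<le> 1" using assms by (simp add: abs_square_le_1)
  have key: "(3 * a\<^sup>2 - 1) * b\<^sup>2 \<le> (1 + a\<^sup>2) * (3 * m\<^sup>2 + 12 * a\<^sup>2 * m)"
  proof (cases "m = 0")
    case True
    with m have "3 * a\<^sup>2 - 1 \<le> 0" by simp
    then show ?thesis using True by (simp add: mult_nonpos_nonneg)
  next
    case False
    then have a: "a\<^sup>2 = m + 1/4" by (auto simp: m_def well_def max_def split: if_splits)
    have "(3 * a\<^sup>2 - 1) * b\<^sup>2 \<le> 3 * m * b\<^sup>2" unfolding a
      by (rule mult_right_mono) auto
    also have "\<dots> \<le> 3 * m * 1" by (rule mult_left_mono[OF b]) (use m in auto)
    also have "\<dots> \<le> (1 + a\<^sup>2) * (3 * m\<^sup>2 + 12 * a\<^sup>2 * m)"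
    proof -
      have "3 * m \<le> 3 * m\<^sup>2 + 12 * a\<^sup>2 * m" unfolding a using m(1)
        by (simp add: power2_eq_square algebra_simps)
      also have "\<dots> \<le> (1 + a\<^sup>2) * (3 * m\<^sup>2 + 12 * a\<^sup>2 * m)"
        using m(1) by (simp add: algebra_simps)
      finally show ?thesis by simp
    qed
    finally show ?thesis .
  qed
  have "(1 + a\<^sup>2) * hessF a b c d
      = 2 * ((1 + a\<^sup>2) * d + 2 * a * b * c)\<^sup>2
        + 2 * c\<^sup>2 * ((1 + a\<^sup>2) * (3 * m\<^sup>2 + 12 * a\<^sup>2 * m) - (3 * a\<^sup>2 - 1) * b\<^sup>2)"
    unfolding hessF_def m_def[symmetric] by algebra
  also have "\<dots> \<ge> 0" using key by simp
  finally show ?thesis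
    by (metis add_pos_nonneg zero_le_mult_iff zero_le_power2 zero_less_one not_less)
qed

lemma F_convex_on_segment:
  assumes "\<bar>b\<bar> \<le> 1" "\<bar>b'\<bar> \<le> 1"
  shows "convex_on {0..1} (\<lambda>s. F (a + s * (a' - a)) (b + s * (b' - b)))"
proof (rule f''_ge0_imp_convex[OF _ DERIV_F_line DERIV_F_line2])
  fix s :: real assume s: "s \<in> {0..1}"
  have "b + s * (b' - b) = (1 - s) * b + s * b'" by (simp add: algebra_simps)
  also have "\<bar>\<dots>\<bar> \<le> (1 - s) * \<bar>b\<bar> + s * \<bar>b'\<bar>"
    using s abs_triangle_ineq[of "(1 - s) * b" "s * b'"] by (simp add: abs_mult)
  also have "\<dots> \<le> (1 - s) * 1 + s * 1"
    by (intro add_mono mult_left_mono) (use s assms in auto)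
  finally have "\<bar>b + s * (b' - b)\<bar> \<le> 1" by simp
  then show "hessF (a + s * (a' - a)) (b + s * (b' - b)) (a' - a) (b' - b) \<ge> 0"
    by (rule hessF_nonneg)
qed auto

lemma F_convex:
  assumes "\<bar>b\<bar> \<le> 1" "\<bar>b'\<bar> \<le> 1" "0 \<le> t" "t \<le> 1"
  shows "F ((1 - t) * a + t * a') ((1 - t) * b + t * b') \<le> (1 - t) * F a b + t * F a' b'"
  using convex_onD[OF F_convex_on_segment[OF assms(1,2), of a a'], of t 0 1] assms(3,4)
  by (simp add: algebra_simps)

lemma diff_mult_le:
  fixes a b a' b' :: real
  assumes "\<bar>a\<bar> \<le> A" "\<bar>b'\<bar> \<le> B" "\<bar>a - a'\<bar> \<le> K * e" "\<bar>b - b'\<bar> \<le> K' * e"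
  shows "\<bar>a * b - a' * b'\<bar> \<le> (A * K' + B * K) * e"
proof -
  have "a * b - a' * b' = a * (b - b') + b' * (a - a')" by (simp add: algebra_simps)
  also have "\<bar>\<dots>\<bar> \<le> \<bar>a\<bar> * \<bar>b - b'\<bar> + \<bar>b'\<bar> * \<bar>a - a'\<bar>"
    using abs_triangle_ineq[of "a * (b - b')" "b' * (a - a')"] by (simp add: abs_mult)
  also have "\<dots> \<le> A * (K' * e) + B * (K * e)"
    by (intro add_mono mult_mono assms) (use assms in auto)
  finally show ?thesis by (simp add: algebra_simps)
qed

text \<open>
  The partial derivatives are polynomials in \<open>a\<close>, \<open>b\<close> and \<open>well a\<close>, all bounded and Lipschitz on
  the box in question, so that \<open>diff_mult_le\<close> applies factor by factor. The constant is generous.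
\<close>

lemma dF_lipschitz:
  assumes a: "\<bar>a\<bar> \<le> 4" "\<bar>a'\<bar> \<le> 4" and b: "\<bar>b\<bar> \<le> 1" "\<bar>b'\<bar> \<le> 1"
    and e: "\<bar>a - a'\<bar> \<le> e" "\<bar>b - b'\<bar> \<le> e"
  shows "\<bar>dF1 a b - dF1 a' b'\<bar> \<le> 10000 * e" "\<bar>dF2 a b - dF2 a' b'\<bar> \<le> 10000 * e"
proof -
  have e0: "e \<ge> 0" using e by linarith
  have sq: "\<bar>a\<^sup>2 - a'\<^sup>2\<bar> \<le> 8 * e" "\<bar>b\<^sup>2 - b'\<^sup>2\<bar> \<le> 2 * e"
    using diff_mult_le[of a 4 a' 4 a' 1 e a 1] diff_mult_le[of b 1 b' 1 b' 1 e b 1] a b e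
    by (auto simp: power2_eq_square)
  have bd: "a\<^sup>2 \<le> 16" "a'\<^sup>2 \<le> 16" "b\<^sup>2 \<le> 1" "b'\<^sup>2 \<le> 1"
    using power_mono[of "\<bar>a\<bar>" 4 2] power_mono[of "\<bar>a'\<bar>" 4 2] power_mono[of "\<bar>b\<bar>" 1 2]
      power_mono[of "\<bar>b'\<bar>" 1 2] a b by auto
  have w: "\<bar>well a - well a'\<bar> \<le> 8 * e" using sq(1) by (auto simp: well_def)
  have wb: "\<bar>well a\<bar> \<le> 16" "\<bar>well a'\<bar> \<le> 16" using bd by (auto simp: well_def)
  have w2: "\<bar>(well a)\<^sup>2 - (well a')\<^sup>2\<bar> \<le> 256 * e"
    using diff_mult_le[OF wb w w] by (simp add: power2_eq_square)
  have w2b: "\<bar>(well a')\<^sup>2\<bar> \<le> 256"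
    using power_mono[OF wb(2), of 2] by simp
  have 1: "\<bar>a * b\<^sup>2 - a' * b'\<^sup>2\<bar> \<le> 9 * e"
    using diff_mult_le[of a 4 "b'\<^sup>2" 1 a' 1 e "b\<^sup>2" 2] a bd sq e by auto
  have 2: "\<bar>a * (well a)\<^sup>2 - a' * (well a')\<^sup>2\<bar> \<le> 1280 * e"
    using diff_mult_le[of a 4 "(well a')\<^sup>2" 256 a' 1 e "(well a)\<^sup>2" 256] a w2 w2b e by auto
  have 3: "\<bar>b * a\<^sup>2 - b' * a'\<^sup>2\<bar> \<le> 24 * e"
    using diff_mult_le[of b 1 "a'\<^sup>2" 16 b' 1 e "a\<^sup>2" 8] b bd sq e by auto
  have "\<bar>2 * p + 6 * q\<bar> \<le> 10000 * e" if "\<bar>p\<bar> \<le> 9 * e" "\<bar>q\<bar> \<le> 1280 * e" for p q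
    using that e0 by linarith
  from this[OF 1 2] show "\<bar>dF1 a b - dF1 a' b'\<bar> \<le> 10000 * e"
    by (simp add: dF1_def right_diff_distrib mult.assoc)
  have "\<bar>2 * p + 2 * q\<bar> \<le> 10000 * e" if "\<bar>p\<bar> \<le> e" "\<bar>q\<bar> \<le> 24 * e" for p q
    using that e0 by linarith
  from this[OF e(2) 3] show "\<bar>dF2 a b - dF2 a' b'\<bar> \<le> 10000 * e"
    by (simp add: dF2_def algebra_simps)
qed

section \<open>One Frank-Wolfe step\<close>

lemma F_uminus: "F (- a) b = F a b"
  by (simp add: F_def well_def)

text \<open>
  The line through the corner \<open>(3, 0)\<close> with slope \<open>- k\<close>. The difference of the two
  values of $(3 - a)^2 (1 + a^2)$ factors as $(a - 1/2)^2 ((a - 5/2)^2 - 3/2)$, and the second factor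
  is positive up to $5/2 - \sqrt{3/2} > 5/4$. It turns negative further towards the corner,
  so uniqueness on the whole segment needs convexity in addition.
\<close>

lemma F_line_strict:
  assumes "-1/2 \<le> a" "a < 5/4" "a \<noteq> 1/2" and k: "k > 0"
  shows "F a (k * (3 - a)) > F (1/2) (k * (5/2))"
proof -
  have "(a - 5/2)\<^sup>2 \<ge> (5/4)\<^sup>2"
    using power_mono[of "5/4" "5/2 - a" 2] assms by (simp add: power2_commute)
  then have "(a - 5/2)\<^sup>2 - 3/2 > 0" by (simp add: power2_eq_square)
  then have "k\<^sup>2 * ((a - 1/2)\<^sup>2 * ((a - 5/2)\<^sup>2 - 3/2)) > 0" using assms by simp
  also have "k\<^sup>2 * ((a - 1/2)\<^sup>2 * ((a - 5/2)\<^sup>2 - 3/2))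
      = (k * (3 - a))\<^sup>2 * (1 + a\<^sup>2) - (k * (5/2))\<^sup>2 * (1 + (1/2)\<^sup>2)"
    by (simp add: field_simps power2_eq_square)
  finally have "(k * (5/2))\<^sup>2 * (1 + (1/2)\<^sup>2) < (k * (3 - a))\<^sup>2 * (1 + a\<^sup>2)" by linarith
  moreover have "well a ^ 3 \<ge> 0" by (intro zero_le_power well_nonneg)
  moreover have "F (1/2) (k * (5/2)) = (k * (5/2))\<^sup>2 * (1 + (1/2)\<^sup>2)" by (simp add: F_def)
  ultimately show ?thesis unfolding F_def[of a] by linarith
qed

text \<open>
  A competitor \<open>s\<close> anywhere on the segment would, by convexity, yield a competitor \<open>r\<close> a quarter of
  the way from \<open>2/7\<close> to \<open>s\<close>, and \<open>r\<close> falls in the range covered by \<open>F_line_strict\<close>. The sign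
  \<open>\<sigma>\<close> records above which end of the segment of minimizers the iterate lies.
\<close>

lemma line_minimizer_unique:
  assumes y: "0 < y" "y \<le> 1" and \<sigma>: "\<sigma> = 1 \<or> \<sigma> = (-1::real)"
    and s: "0 \<le> s" "s \<le> 1"
    and le: "F (\<sigma>/2 + s * (- 3 * \<sigma> - \<sigma>/2)) (y + s * (0 - y)) \<le>
             F (\<sigma>/2 + 2/7 * (- 3 * \<sigma> - \<sigma>/2)) (y + 2/7 * (0 - y))"
  shows "s = 2/7"
proof (rule ccontr)
  assume ne: "s \<noteq> 2/7"
  \<comment> \<open>By the symmetry of \<open>F\<close> only the step from the left end to the corner \<open>(3, 0)\<close> matters.\<close>
  define \<phi> where "\<phi> = (\<lambda>s. F (-1/2 + s * (3 - (-1/2))) (y + s * (0 - y)))"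
  have phi: "F (\<sigma>/2 + s * (- 3 * \<sigma> - \<sigma>/2)) (y + s * (0 - y)) = \<phi> s" for s
  proof -
    have "\<sigma>/2 + s * (- 3 * \<sigma> - \<sigma>/2) = - \<sigma> * (-1/2 + s * (3 - (-1/2)))"
      by (simp add: algebra_simps)
    with \<sigma> show ?thesis
      using F_uminus[of "-1/2 + s * (3 - (-1/2))"] by (auto simp: \<phi>_def)
  qed
  have le: "\<phi> s \<le> \<phi> (2/7)" using le unfolding phi .
  have conv: "convex_on {0..1} \<phi>"
    unfolding \<phi>_def by (rule F_convex_on_segment) (use y in auto)
  define r where "r = (1 - 1/4) * (2/7) + 1/4 * s"
  have "\<phi> r \<le> (1 - 1/4) * \<phi> (2/7) + 1/4 * \<phi> s"
    using convex_onD[OF conv, of "1/4" "2/7" s] s by (simp add: r_def)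
  also have "\<dots> \<le> \<phi> (2/7)" using le by simp
  finally have "\<phi> r \<le> \<phi> (2/7)" .
  moreover have "\<phi> r > \<phi> (2/7)"
  proof -
    define a where "a = -1/2 + r * (7/2)"
    have "-1/2 \<le> a" "a < 5/4" "a \<noteq> 1/2" using s ne by (auto simp: a_def r_def)
    from F_line_strict[OF this, of "y * 2/7"] y
    have "F a (y * 2/7 * (3 - a)) > F (1/2) (y * 2/7 * (5/2))" by simp
    moreover have "\<phi> r = F a (y * 2/7 * (3 - a))"
      by (simp add: \<phi>_def a_def algebra_simps)
    moreover have "\<phi> (2/7) = F (1/2) (y * 2/7 * (5/2))"
      by (simp add: \<phi>_def algebra_simps)
    ultimately show ?thesis by simp
  qed
  ultimately show False by simp
qed

section \<open>Transfer to the plane\<close>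

definition obj :: "(nat \<Rightarrow> real) \<Rightarrow> real"
  where "obj x = F (x 0) (x 1)"

definition grad :: "(nat \<Rightarrow> real) \<Rightarrow> nat \<Rightarrow> real"
  where "grad x = (\<lambda>i. if i = 0 then dF1 (x 0) (x 1) else if i = 1 then dF2 (x 0) (x 1) else 0)"

definition rect :: "(nat \<Rightarrow> real) set"
  where "rect = {x \<in> Rn 2. \<bar>x 0\<bar> \<le> 3 \<and> 0 \<le> x 1 \<and> x 1 \<le> 1/2}"

definition nbhd :: "(nat \<Rightarrow> real) set"
  where "nbhd = {x \<in> Rn 2. \<bar>x 0\<bar> < 4 \<and> \<bar>x 1\<bar> < 1}"

definition pt :: "real \<Rightarrow> real \<Rightarrow> nat \<Rightarrow> real"
  where "pt a b = (\<lambda>i. if i = 0 then a else if i = 1 then b else 0)"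

lemma pt_simps [simp]: "pt a b 0 = a" "pt a b (Suc 0) = b" "pt a b \<in> Rn 2"
  by (auto simp: pt_def topspace_Euclidean_space)

lemma Rn2_eqI:
  assumes "x \<in> Rn 2" "y \<in> Rn 2" "x 0 = y 0" "x 1 = y 1"
  shows "x = y"
proof
  fix i :: nat
  consider "i = 0" | "i = 1" | "i \<ge> 2" by linarith
  then show "x i = y i" using assms by cases (auto simp: topspace_Euclidean_space)
qed

lemma inner_Rn_2: "inner_Rn 2 x y = x 0 * y 0 + x 1 * y 1"
  by (simp add: inner_Rn_def numeral_2_eq_2)

lemma norm_Rn_2: "norm_Rn 2 x = sqrt ((x 0)\<^sup>2 + (x 1)\<^sup>2)"
  by (simp add: norm_Rn_def L2_set_def numeral_2_eq_2)

lemma norm_Rn_2_bounds: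
  "\<bar>x 0\<bar> \<le> norm_Rn 2 x" "\<bar>x 1\<bar> \<le> norm_Rn 2 x" "norm_Rn 2 x \<le> \<bar>x 0\<bar> + \<bar>x 1\<bar>"
  unfolding norm_Rn_2
  using sqrt_sum_squares_le_sum_abs[of "x 0" "x 1"] real_sqrt_sum_squares_ge1[of "x 0" "x 1"] 
    real_sqrt_sum_squares_ge2[of "x 1" "x 0"]
  by (auto simp: abs_le_iff intro: real_le_rsqrt)

lemma continuous_map_Rn_component: "continuous_map (Euclidean_space n) euclideanreal (\<lambda>x. x i)"
  unfolding Euclidean_space_def
  by (intro continuous_map_from_subtopology continuous_map_product_projection) auto

lemma openin_nbhd: "openin (Euclidean_space 2) nbhd"
proof -
  have "nbhd = {x \<in> Rn 2. x 0 \<in> {-4<..<4}} \<inter> {x \<in> Rn 2. x 1 \<in> {-1<..<1}}"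
    by (auto simp: nbhd_def)
  also have "openin (Euclidean_space 2) \<dots>"
    by (intro openin_Int openin_continuous_map_preimage[OF continuous_map_Rn_component]) auto
  finally show ?thesis .
qed

lemma compactin_rect: "compactin (Euclidean_space 2) rect"
proof -
  define S :: "nat \<Rightarrow> real set"
    where "S = (\<lambda>i. if i = 0 then {-3..3} else if i = 1 then {0..1/2} else {0})"
  have "rect = PiE UNIV S"
  proof (intro set_eqI iffI)
    fix x assume "x \<in> PiE UNIV S"
    then have "x i \<in> S i" for i by auto
    then have "x 0 \<in> S 0" "x 1 \<in> S 1" "\<And>i. i \<ge> 2 \<Longrightarrow> x i \<in> S i" by blast+
    then show "x \<in> rect"
      by (auto simp: rect_def S_def topspace_Euclidean_space)
  qed (auto simp: rect_def S_def topspace_Euclidean_space)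
  moreover have "compactin (powertop_real UNIV) (PiE UNIV S)"
    by (auto simp: compactin_PiE S_def)
  moreover have "rect \<subseteq> {x. \<forall>i\<ge>2. x i = 0}"
    by (auto simp: rect_def topspace_Euclidean_space)
  ultimately show ?thesis
    by (simp add: Euclidean_space_def compactin_subtopology)
qed

lemma convex_rect: "convex rect"
proof (rule convexI)
  fix x y :: "nat \<Rightarrow> real" and u v :: real
  assume *: "x \<in> rect" "y \<in> rect" "0 \<le> u" "0 \<le> v" "u + v = 1"
  have "u * x i + v * y i \<in> {l..r}" if "x i \<in> {l..r}" "y i \<in> {l..r}" for i l r
    using convexD[of "{l..r}" "x i" "y i" u v] that * by simp
  from this[of 0 "-3" 3] this[of 1 0 "1/2"] show "u *\<^sub>R x + v *\<^sub>R y \<in> rect"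
    using * by (auto simp: rect_def topspace_Euclidean_space abs_le_iff)
qed

lemma convex_nbhd: "convex nbhd"
proof (rule convexI)
  fix x y :: "nat \<Rightarrow> real" and u v :: real
  assume *: "x \<in> nbhd" "y \<in> nbhd" "0 \<le> u" "0 \<le> v" "u + v = 1"
  have "u * x i + v * y i \<in> {l<..<r}" if "x i \<in> {l<..<r}" "y i \<in> {l<..<r}" for i l r
    using convexD[of "{l<..<r}" "x i" "y i" u v] that * by simp
  from this[of 0 "-4" 4] this[of 1 "-1" 1] show "u *\<^sub>R x + v *\<^sub>R y \<in> nbhd"
    using * by (auto simp: nbhd_def topspace_Euclidean_space abs_less_iff)
qed

lemma convex_on_obj: "convex_on nbhd obj"
proof (rule convex_onI[OF _ convex_nbhd])
  fix t :: real and x y :: "nat \<Rightarrow> real"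
  assume "0 < t" "t < 1" "x \<in> nbhd" "y \<in> nbhd"
  then show "obj ((1 - t) *\<^sub>R x + t *\<^sub>R y) \<le> (1 - t) * obj x + t * obj y"
    using F_convex[of "x 1" "y 1" t "x 0" "y 0"] by (simp add: obj_def nbhd_def)
qed

lemma grad_lipschitz:
  assumes "x \<in> nbhd" "y \<in> nbhd"
  shows "norm_Rn 2 (grad x - grad y) \<le> 20000 * norm_Rn 2 (x - y)"
proof -
  have "\<bar>dF1 (x 0) (x 1) - dF1 (y 0) (y 1)\<bar> \<le> 10000 * norm_Rn 2 (x - y)"
    "\<bar>dF2 (x 0) (x 1) - dF2 (y 0) (y 1)\<bar> \<le> 10000 * norm_Rn 2 (x - y)"
    by (rule dF_lipschitz; use assms norm_Rn_2_bounds[of "x - y"] in \<open>simp add: nbhd_def\<close>)+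
  then show ?thesis
    using norm_Rn_2_bounds(3)[of "grad x - grad y"] by (simp add: grad_def)
qed

text \<open>
  The mean value theorem on the segment expresses the remainder through the increment of
  the gradient, which is Lipschitz.
\<close>

lemma obj_taylor:
  assumes x: "x \<in> nbhd" and y: "y \<in> nbhd"
  shows "\<bar>obj y - obj x - inner_Rn 2 (grad x) (y - x)\<bar> \<le> 20000 * (norm_Rn 2 (y - x))\<^sup>2"
proof -
  define c d N where "c = y 0 - x 0" and "d = y 1 - x 1" and "N = norm_Rn 2 (y - x)"
  define \<phi>' where "\<phi>' = (\<lambda>s. dF1 (x 0 + s * c) (x 1 + s * d) * c + dF2 (x 0 + s * c) (x 1 + s * d) * d)"
  have deriv: "((\<lambda>s. F (x 0 + s * c) (x 1 + s * d)) has_real_derivative \<phi>' s) (at s)" for s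
    unfolding \<phi>'_def by (rule DERIV_F_line)
  obtain s where s: "0 < s" "s < 1"
    and "F (x 0 + 1 * c) (x 1 + 1 * d) - F (x 0 + 0 * c) (x 1 + 0 * d) = (1 - 0) * \<phi>' s"
    using MVT2[OF zero_less_one deriv] by blast
  then have "obj y - obj x - inner_Rn 2 (grad x) (y - x) = \<phi>' s - \<phi>' 0"
    by (simp add: obj_def c_def d_def inner_Rn_2 grad_def \<phi>'_def)
  also have "\<dots> = (dF1 (x 0 + s * c) (x 1 + s * d) - dF1 (x 0) (x 1)) * c
      + (dF2 (x 0 + s * c) (x 1 + s * d) - dF2 (x 0) (x 1)) * d" (is "_ = ?A * c + ?B * d")
    by (simp add: \<phi>'_def algebra_simps)
  finally have eq: "obj y - obj x - inner_Rn 2 (grad x) (y - x) = ?A * c + ?B * d" .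
  have "(1 - s) *\<^sub>R x + s *\<^sub>R y \<in> nbhd"
    using convexD[OF convex_nbhd x y, of "1 - s" s] s by simp
  moreover have "((1 - s) *\<^sub>R x + s *\<^sub>R y) 0 = x 0 + s * c"
    "((1 - s) *\<^sub>R x + s *\<^sub>R y) 1 = x 1 + s * d"
    by (simp_all add: c_def d_def algebra_simps)
  ultimately have z: "\<bar>x 0 + s * c\<bar> \<le> 4" "\<bar>x 1 + s * d\<bar> \<le> 1"
    unfolding nbhd_def by simp_all
  have x': "\<bar>x 0\<bar> \<le> 4" "\<bar>x 1\<bar> \<le> 1" using x by (simp_all add: nbhd_def)
  have N: "\<bar>c\<bar> \<le> N" "\<bar>d\<bar> \<le> N" using norm_Rn_2_bounds[of "y - x"] by (simp_all add: c_def d_def N_def)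
  have sN: "\<bar>x 0 + s * c - x 0\<bar> \<le> N" "\<bar>x 1 + s * d - x 1\<bar> \<le> N"
    using s N mult_mono[of s 1 "\<bar>c\<bar>" N] mult_mono[of s 1 "\<bar>d\<bar>" N] by (simp_all add: abs_mult)
  note AB = dF_lipschitz[OF z(1) x'(1) z(2) x'(2) sN]
  have "\<bar>?A * c\<bar> \<le> (10000 * N) * N" "\<bar>?B * d\<bar> \<le> (10000 * N) * N"
    unfolding abs_mult by (rule mult_mono[OF AB(1) N(1)] mult_mono[OF AB(2) N(2)]; use N in simp)+
  then show ?thesis unfolding eq N_def[symmetric] power2_eq_square by linarith
qed

lemma has_gradient_obj:
  assumes x: "x \<in> nbhd"
  shows "has_gradient_Rn 2 obj (grad x) x"
  unfolding has_gradient_Rn_def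
proof
  show "grad x \<in> Rn 2" by (auto simp: grad_def topspace_Euclidean_space)
  have xE: "x \<in> Rn 2" using x by (simp add: nbhd_def)
  have "continuous_map (Euclidean_space 2) euclideanreal (\<lambda>y. norm_Rn 2 (y - x))"
    unfolding norm_Rn_2 by (auto intro!: continuous_intros continuous_map_Rn_component)
  then have "limitin euclideanreal (\<lambda>y. norm_Rn 2 (y - x)) (norm_Rn 2 (x - x)) (atin (Euclidean_space 2) x)"
    using xE unfolding continuous_map_atin by blast
  moreover have "norm_Rn 2 (x - x) = 0" by (simp add: norm_Rn_2)
  ultimately have "((\<lambda>y. norm_Rn 2 (y - x)) \<longlongrightarrow> 0) (atin (Euclidean_space 2) x)"
    by simp
  then have lim: "((\<lambda>y. 20000 * norm_Rn 2 (y - x)) \<longlongrightarrow> 0) (atin (Euclidean_space 2) x)"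
    using tendsto_mult_right_zero by blast
  have "eventually (\<lambda>y. y \<in> nbhd) (atin (Euclidean_space 2) x)"
    using openin_nbhd x xE by (auto simp: eventually_atin)
  then have ev: "eventually (\<lambda>y. norm ((obj y - obj x - inner_Rn 2 (grad x) (y - x)) / norm_Rn 2 (y - x))
      \<le> 20000 * norm_Rn 2 (y - x)) (atin (Euclidean_space 2) x)"
  proof eventually_elim
    case (elim y)
    have "norm_Rn 2 (y - x) \<ge> 0" by (simp add: norm_Rn_2)
    with obj_taylor[OF x elim] show ?case
      by (cases "norm_Rn 2 (y - x) = 0") (auto simp: field_simps power2_eq_square)
  qed
  show "((\<lambda>y. (obj y - obj x - inner_Rn 2 (grad x) (y - x)) / norm_Rn 2 (y - x)) \<longlongrightarrow> 0)
      (atin (Euclidean_space 2) x)"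
    by (rule Lim_null_comparison[OF ev lim])
qed

section \<open>The iterates\<close>

text \<open>
  The gradient at $(\sigma/2, y)$ is $(\sigma y^2, 5y/2)$. Neither component vanishes, so the
  minimizer of the linear objective over the rectangle is a single corner.
\<close>

lemma lmo_unique:
  assumes y: "0 < y" and \<sigma>: "\<sigma> = 1 \<or> \<sigma> = (-1::real)"
    and v: "is_arg_min (\<lambda>w. inner_Rn 2 w (grad (pt (\<sigma>/2) y))) (\<lambda>w. w \<in> rect) v"
  shows "v = pt (- 3 * \<sigma>) 0"
proof -
  have vb: "v \<in> rect" using v by (simp add: is_arg_min_def)
  have "pt (- 3 * \<sigma>) 0 \<in> rect" using \<sigma> by (auto simp: rect_def)
  with v have "inner_Rn 2 v (grad (pt (\<sigma>/2) y)) \<le> inner_Rn 2 (pt (- 3 * \<sigma>) 0) (grad (pt (\<sigma>/2) y))"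
    by (auto simp: is_arg_min_def not_less)
  moreover have "inner_Rn 2 w (grad (pt (\<sigma>/2) y)) = \<sigma> * w 0 * y\<^sup>2 + w 1 * (5/2 * y)" for w
    using \<sigma> by (auto simp: inner_Rn_2 grad_def dF1_def dF2_def power2_eq_square)
  ultimately have "\<sigma> * v 0 * y\<^sup>2 + v 1 * (5/2 * y) \<le> - 3 * (\<sigma> * \<sigma>) * y\<^sup>2"
    by (simp add: mult.assoc)
  then have "(\<sigma> * v 0 + 3) * y\<^sup>2 + v 1 * (5/2 * y) \<le> 0"
    using \<sigma> by (auto simp: algebra_simps)
  moreover have "(\<sigma> * v 0 + 3) * y\<^sup>2 \<ge> 0" "v 1 * (5/2 * y) \<ge> 0"
    using vb y \<sigma> by (auto simp: rect_def abs_le_iff)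
  ultimately have "(\<sigma> * v 0 + 3) * y\<^sup>2 = 0" "v 1 * (5/2 * y) = 0" by linarith+
  then have "v 0 = - 3 * \<sigma>" "v 1 = 0" using y \<sigma> by auto
  then show ?thesis using vb by (intro Rn2_eqI) (auto simp: rect_def)
qed

lemma frank_wolfe_step:
  assumes run: "frank_wolfe_run 2 grad rect x v \<gamma>" and ls: "line_search obj x v \<gamma>"
    and y: "0 < y" "y \<le> 1" and \<sigma>: "\<sigma> = 1 \<or> \<sigma> = (-1::real)"
    and xt: "x t = pt (\<sigma>/2) y"
  shows "x (Suc t) = pt (- \<sigma>/2) (5/7 * y)"
proof -
  have v: "v t = pt (- 3 * \<sigma>) 0"
    using run xt by (intro lmo_unique[OF y(1) \<sigma>]) (metis frank_wolfe_run_def)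
  have am: "is_arg_min (\<lambda>s. obj (x t + s *\<^sub>R (v t - x t))) (\<lambda>s. s \<in> {0..1}) (\<gamma> t)"
    using ls by (simp add: line_search_def)
  have "\<gamma> t = 2/7"
  proof (rule line_minimizer_unique[OF y \<sigma>])
    show "0 \<le> \<gamma> t" "\<gamma> t \<le> 1" using am by (auto simp: is_arg_min_def)
    have "obj (x t + \<gamma> t *\<^sub>R (v t - x t)) \<le> obj (x t + (2/7) *\<^sub>R (v t - x t))"
      using am by (auto simp: is_arg_min_def not_less)
    then show "F (\<sigma>/2 + \<gamma> t * (- 3 * \<sigma> - \<sigma>/2)) (y + \<gamma> t * (0 - y)) \<le>
             F (\<sigma>/2 + 2/7 * (- 3 * \<sigma> - \<sigma>/2)) (y + 2/7 * (0 - y))"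
      by (simp add: obj_def v xt)
  qed
  then have "x (Suc t) = (1 - 2/7) *\<^sub>R x t + (2/7) *\<^sub>R v t"
    using run unfolding frank_wolfe_run_def by metis
  then show ?thesis
    unfolding v xt by (auto simp: fun_eq_iff pt_def)
qed

lemma frank_wolfe_iterates:
  assumes run: "frank_wolfe_run 2 grad rect x v \<gamma>" and ls: "line_search obj x v \<gamma>"
    and x0: "x 0 = pt (1/2) (1/2)"
  shows "x t = pt ((-1) ^ t / 2) ((5/7) ^ t / 2)"
proof (induction t)
  case 0
  show ?case using x0 by simp
next
  case (Suc t)
  have "(5/7 :: real) ^ t \<le> 1" by (simp add: power_le_one)
  moreover have "(-1) ^ t = (1::real) \<or> (-1) ^ t = (-1::real)"
    by (cases "even t") auto
  ultimately have "x (Suc t) = pt (- ((-1) ^ t) / 2) (5/7 * ((5/7) ^ t / 2))"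
    using frank_wolfe_step[OF run ls _ _ _ Suc.IH] by simp
  then show ?case by simp
qed

text \<open>A limit would force the increments of the first coordinate, which have modulus \<open>1\<close>, to vanish.\<close>

lemma alternating_not_limitin:
  assumes x: "\<And>t. x t 0 = (-1) ^ t / (2::real)"
  shows "\<not> limitin (Euclidean_space n) x l sequentially"
proof
  assume "limitin (Euclidean_space n) x l sequentially"
  from continuous_map_limit[OF continuous_map_Rn_component[of n 0] this]
  have lim: "(\<lambda>t. x t 0) \<longlonglongrightarrow> l 0" by (simp add: o_def)
  then have "(\<lambda>t. x (Suc t) 0) \<longlonglongrightarrow> l 0" by (rule LIMSEQ_Suc)
  from tendsto_diff[OF this lim] have "(\<lambda>t. \<bar>x (Suc t) 0 - x t 0\<bar>) \<longlonglongrightarrow> 0"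
    using tendsto_rabs_zero by fastforce
  moreover have "\<bar>x (Suc t) 0 - x t 0\<bar> = 1" for t
    by (simp add: x)
  ultimately show False by (simp add: tendsto_const_iff)
qed

theorem mainTheorem1:
  shows "\<exists>(n::nat) (L::real) (C::(nat \<Rightarrow> real) set) (D::(nat \<Rightarrow> real) set)
            (f::(nat \<Rightarrow> real) \<Rightarrow> real) (g::(nat \<Rightarrow> real) \<Rightarrow> (nat \<Rightarrow> real)) (x0::nat \<Rightarrow> real).
           L > 0 \<and>
           C \<noteq> {} \<and> compactin (Euclidean_space n) C \<and> convex C \<and>
           openin (Euclidean_space n) D \<and> convex D \<and> C \<subseteq> D \<and>
           convex_on D f \<and>
           (\<forall>x\<in>D. has_gradient_Rn n f (g x) x) \<and>
           (\<forall>x\<in>D. \<forall>y\<in>D. norm_Rn n (g x - g y) \<le> L * norm_Rn n (x - y)) \<and>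
           x0 \<in> C \<and>
           (\<forall>x v \<gamma>. x 0 = x0 \<and> frank_wolfe_run n g C x v \<gamma> \<and> line_search f x v \<gamma> \<longrightarrow>
              \<not> (\<exists>l. limitin (Euclidean_space n) x l sequentially))"
proof (rule exI[of _ 2], rule exI[of _ 20000], rule exI[of _ rect], rule exI[of _ nbhd],
    rule exI[of _ obj], rule exI[of _ grad], rule exI[of _ "pt (1/2) (1/2)"],
    intro conjI ballI allI impI)
  show "(20000::real) > 0" by simp
  show start: "pt (1/2) (1/2) \<in> rect" by (simp add: rect_def)
  then show "rect \<noteq> {}" by blast
  show "rect \<subseteq> nbhd" by (auto simp: rect_def nbhd_def)
  fix x v \<gamma>
  assume "x 0 = pt (1/2) (1/2) \<and> frank_wolfe_run 2 grad rect x v \<gamma> \<and> line_search obj x v \<gamma>"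
  then have "x t 0 = (-1) ^ t / 2" for t
    by (simp add: frank_wolfe_iterates[of x v \<gamma>])
  then show "\<not> (\<exists>l. limitin (Euclidean_space 2) x l sequentially)"
    using alternating_not_limitin by blast
qed (fact compactin_rect convex_rect openin_nbhd convex_nbhd convex_on_obj
       has_gradient_obj grad_lipschitz)+

end
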